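(* Let $B$ be a Brandt semigroup that is not a zero group. Then, for every $e\in E(B)\smallsetminus\{0\}$, the principal ideals $eB=\{eb: b\in B\}$ and $Be=\{be : b\in B\}$ are, respectively, a strict left ample and a strict right ample subsemigroup of $B$.
   Context: A Brandt semigroup is a completely $0$-simple inverse semigroup; up to isomorphism it is $B=(I\times G\times I)\cup\{0\}$ for a non-empty set $I$ and a group $G$, with $0$ a zero element and $(i,a,\lambda)(j,b,\mu)=(i,ab,\mu)$ if $\lambda=j$ and $=0$ otherwise. A zero group is a semigroup $G^0$ obtained from a group $G$ by externally adjoining a zero element. $E(B)$ is the set of idempotents of $B$. Maps are written to the right of their arguments. A semigroup $S$ is left ample if there are an inverse semigroup $T$ and an injective homomorphism $\phi:S\to T$ such that $(x\phi)(x\phi)^{-1}\in S\phi$ for all $x\in S$. It is right ample if there are an inverse semigroup $T$ and an injective homomorphism $\phi:S\to T$ such that $(x\phi)^{-1}(x\phi)\in S\phi$ for all $x\in S$. A semigroup is strict left ample if it is left ample but not right ample, and strict right ample if it is right ample but not left ample. *)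

theory Defs
  imports "HOL-Algebra.Group"
begin

text \<open>
  A semigroup is given by a carrier set \<open>S\<close> and a binary operation \<open>f\<close>, of which only the
  restriction to \<open>S\<close> matters. Semigroups are non-empty.
\<close>

definition semigroup_on :: "'a set \<Rightarrow> ('a \<Rightarrow> 'a \<Rightarrow> 'a) \<Rightarrow> bool" where
  "semigroup_on S f \<longleftrightarrow>
     S \<noteq> {} \<and>
     (\<forall>x\<in>S. \<forall>y\<in>S. f x y \<in> S) \<and>
     (\<forall>x\<in>S. \<forall>y\<in>S. \<forall>z\<in>S. f (f x y) z = f x (f y z))"

definition subsemigroup :: "'a set \<Rightarrow> 'a set \<Rightarrow> ('a \<Rightarrow> 'a \<Rightarrow> 'a) \<Rightarrow> bool" where
  "subsemigroup U S f \<longleftrightarrow> U \<noteq> {} \<and> U \<subseteq> S \<and> (\<forall>x\<in>U. \<forall>y\<in>U. f x y \<in> U)"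

definition idempotents :: "'a set \<Rightarrow> ('a \<Rightarrow> 'a \<Rightarrow> 'a) \<Rightarrow> 'a set" where
  "idempotents S f = {e \<in> S. f e e = e}"

definition is_zero :: "'a set \<Rightarrow> ('a \<Rightarrow> 'a \<Rightarrow> 'a) \<Rightarrow> 'a \<Rightarrow> bool" where
  "is_zero S f z \<longleftrightarrow> z \<in> S \<and> (\<forall>x\<in>S. f z x = z \<and> f x z = z)"

definition two_sided_ideal :: "'a set \<Rightarrow> ('a \<Rightarrow> 'a \<Rightarrow> 'a) \<Rightarrow> 'a set \<Rightarrow> bool" where
  "two_sided_ideal S f A \<longleftrightarrow>
     A \<noteq> {} \<and> A \<subseteq> S \<and> (\<forall>s\<in>S. \<forall>a\<in>A. f s a \<in> A \<and> f a s \<in> A)"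

definition zero_simple :: "'a set \<Rightarrow> ('a \<Rightarrow> 'a \<Rightarrow> 'a) \<Rightarrow> 'a \<Rightarrow> bool" where
  "zero_simple S f z \<longleftrightarrow>
     semigroup_on S f \<and> is_zero S f z \<and>
     {f x y | x y. x \<in> S \<and> y \<in> S} \<noteq> {z} \<and>
     (\<forall>A. two_sided_ideal S f A \<longrightarrow> A = {z} \<or> A = S)"

text \<open>Minimality is with respect to the natural order: \<open>g \<le> e\<close> iff \<open>e g = g = g e\<close>.\<close>

definition primitive_idempotent :: "'a set \<Rightarrow> ('a \<Rightarrow> 'a \<Rightarrow> 'a) \<Rightarrow> 'a \<Rightarrow> 'a \<Rightarrow> bool" where
  "primitive_idempotent S f z e \<longleftrightarrow>
     e \<in> idempotents S f - {z} \<and>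
     (\<forall>g \<in> idempotents S f - {z}. f e g = g \<and> f g e = g \<longrightarrow> g = e)"

definition completely_zero_simple :: "'a set \<Rightarrow> ('a \<Rightarrow> 'a \<Rightarrow> 'a) \<Rightarrow> 'a \<Rightarrow> bool" where
  "completely_zero_simple S f z \<longleftrightarrow>
     zero_simple S f z \<and> (\<exists>e. primitive_idempotent S f z e)"

definition is_inverse :: "('a \<Rightarrow> 'a \<Rightarrow> 'a) \<Rightarrow> 'a \<Rightarrow> 'a \<Rightarrow> bool" where
  "is_inverse f x y \<longleftrightarrow> f (f x y) x = x \<and> f (f y x) y = y"

definition inverse_semigroup :: "'a set \<Rightarrow> ('a \<Rightarrow> 'a \<Rightarrow> 'a) \<Rightarrow> bool" where
  "inverse_semigroup S f \<longleftrightarrow>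
     semigroup_on S f \<and> (\<forall>x\<in>S. \<exists>!y. y \<in> S \<and> is_inverse f x y)"

definition the_inverse :: "'a set \<Rightarrow> ('a \<Rightarrow> 'a \<Rightarrow> 'a) \<Rightarrow> 'a \<Rightarrow> 'a" where
  "the_inverse S f x = (THE y. y \<in> S \<and> is_inverse f x y)"

definition brandt_semigroup :: "'a set \<Rightarrow> ('a \<Rightarrow> 'a \<Rightarrow> 'a) \<Rightarrow> 'a \<Rightarrow> bool" where
  "brandt_semigroup B f z \<longleftrightarrow> completely_zero_simple B f z \<and> inverse_semigroup B f"

definition zero_group :: "'a set \<Rightarrow> ('a \<Rightarrow> 'a \<Rightarrow> 'a) \<Rightarrow> bool" where
  "zero_group S f \<longleftrightarrow>
     (\<exists>z u. is_zero S f z \<and> group \<lparr>carrier = S - {z}, mult = f, one = u\<rparr>)"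

definition semigroup_embedding ::
    "'a set \<Rightarrow> ('a \<Rightarrow> 'a \<Rightarrow> 'a) \<Rightarrow> 'b set \<Rightarrow> ('b \<Rightarrow> 'b \<Rightarrow> 'b) \<Rightarrow> ('a \<Rightarrow> 'b) \<Rightarrow> bool" where
  "semigroup_embedding S f T g \<phi> \<longleftrightarrow>
     \<phi> ` S \<subseteq> T \<and> inj_on \<phi> S \<and> (\<forall>x\<in>S. \<forall>y\<in>S. \<phi> (f x y) = g (\<phi> x) (\<phi> y))"

definition left_ample_embedding ::
    "'a set \<Rightarrow> ('a \<Rightarrow> 'a \<Rightarrow> 'a) \<Rightarrow> 'b set \<Rightarrow> ('b \<Rightarrow> 'b \<Rightarrow> 'b) \<Rightarrow> ('a \<Rightarrow> 'b) \<Rightarrow> bool" where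
  "left_ample_embedding S f T g \<phi> \<longleftrightarrow>
     inverse_semigroup T g \<and> semigroup_embedding S f T g \<phi> \<and>
     (\<forall>x\<in>S. g (\<phi> x) (the_inverse T g (\<phi> x)) \<in> \<phi> ` S)"

definition right_ample_embedding ::
    "'a set \<Rightarrow> ('a \<Rightarrow> 'a \<Rightarrow> 'a) \<Rightarrow> 'b set \<Rightarrow> ('b \<Rightarrow> 'b \<Rightarrow> 'b) \<Rightarrow> ('a \<Rightarrow> 'b) \<Rightarrow> bool" where
  "right_ample_embedding S f T g \<phi> \<longleftrightarrow>
     inverse_semigroup T g \<and> semigroup_embedding S f T g \<phi> \<and>
     (\<forall>x\<in>S. g (the_inverse T g (\<phi> x)) (\<phi> x) \<in> \<phi> ` S)"

text \<open>
  A definition cannot quantify existentially over the type of the elements of \<open>T\<close>. Below, the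
  elements of \<open>T\<close> are taken from the type of terms over \<open>S\<close> in the signature of inverse
  semigroups. This is no restriction: the part of \<open>T\<close> generated by the image of \<open>S\<close> is a
  quotient of the set of these terms, so an embedding into an inverse semigroup over any other
  type can be replaced by one into an inverse semigroup of terms; see
  \<open>left_ample_if_embedding\<close> and \<open>right_ample_if_embedding\<close>.
\<close>

datatype 'a inv_term = Gen 'a | Mul "'a inv_term" "'a inv_term" | Inv "'a inv_term"

definition left_ample :: "'a set \<Rightarrow> ('a \<Rightarrow> 'a \<Rightarrow> 'a) \<Rightarrow> bool" where
  "left_ample S f \<longleftrightarrow>
     semigroup_on S f \<and>
     (\<exists>(T :: 'a inv_term set) g \<phi>. left_ample_embedding S f T g \<phi>)"

definition right_ample :: "'a set \<Rightarrow> ('a \<Rightarrow> 'a \<Rightarrow> 'a) \<Rightarrow> bool" where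
  "right_ample S f \<longleftrightarrow>
     semigroup_on S f \<and>
     (\<exists>(T :: 'a inv_term set) g \<phi>. right_ample_embedding S f T g \<phi>)"

definition strict_left_ample :: "'a set \<Rightarrow> ('a \<Rightarrow> 'a \<Rightarrow> 'a) \<Rightarrow> bool" where
  "strict_left_ample S f \<longleftrightarrow> left_ample S f \<and> \<not> right_ample S f"

definition strict_right_ample :: "'a set \<Rightarrow> ('a \<Rightarrow> 'a \<Rightarrow> 'a) \<Rightarrow> bool" where
  "strict_right_ample S f \<longleftrightarrow> right_ample S f \<and> \<not> left_ample S f"


subsection \<open>Independence of the type of the inverse semigroup\<close>

lemma the_inverse_props:
  assumes "inverse_semigroup T g" and "t \<in> T"
  shows "the_inverse T g t \<in> T" and "is_inverse g t (the_inverse T g t)"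
proof -
  have "\<exists>!y. y \<in> T \<and> is_inverse g t y"
    using assms by (auto simp: inverse_semigroup_def)
  from theI'[OF this] show "the_inverse T g t \<in> T" "is_inverse g t (the_inverse T g t)"
    by (auto simp: the_inverse_def)
qed

lemma the_inverse_eqI:
  assumes "inverse_semigroup T g" and "t \<in> T" and "y \<in> T" and "is_inverse g t y"
  shows "the_inverse T g t = y"
proof -
  have "\<exists>!y. y \<in> T \<and> is_inverse g t y"
    using assms by (auto simp: inverse_semigroup_def)
  with assms(3,4) show ?thesis
    unfolding the_inverse_def by (metis (mono_tags, lifting) the1_equality)
qed

primrec eval_term :: "'b set \<Rightarrow> ('b \<Rightarrow> 'b \<Rightarrow> 'b) \<Rightarrow> ('a \<Rightarrow> 'b) \<Rightarrow> 'a inv_term \<Rightarrow> 'b" where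
  "eval_term T g \<phi> (Gen x) = \<phi> x"
| "eval_term T g \<phi> (Mul u v) = g (eval_term T g \<phi> u) (eval_term T g \<phi> v)"
| "eval_term T g \<phi> (Inv u) = the_inverse T g (eval_term T g \<phi> u)"

lemma inverse_semigroup_of_terms:
  fixes S :: "'a set" and T :: "'b set"
  assumes ne: "S \<noteq> {}" and T: "inverse_semigroup T g" and \<phi>: "semigroup_embedding S f T g \<phi>"
  obtains T' :: "'a inv_term set" and g' and \<psi> :: "'a inv_term \<Rightarrow> 'b" and \<phi>'
  where "inverse_semigroup T' g'" and "semigroup_embedding S f T' g' \<phi>'"
    and "inj_on \<psi> T'" and "\<forall>x\<in>S. \<psi> (\<phi>' x) = \<phi> x"
    and "\<forall>u\<in>T'. \<forall>v\<in>T'. \<psi> (g' u v) = g (\<psi> u) (\<psi> v)"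
    and "\<forall>u\<in>T'. \<psi> (the_inverse T' g' u) = the_inverse T g (\<psi> u)"
proof -
  define W where "W = {w :: 'a inv_term. set_inv_term w \<subseteq> S}"
  define \<psi> where "\<psi> = eval_term T g \<phi>"
  define rep where "rep t = (SOME w. w \<in> W \<and> \<psi> w = t)" for t
  define T0 where "T0 = \<psi> ` W"
  define T' where "T' = rep ` T0"
  define g' where "g' u v = rep (g (\<psi> u) (\<psi> v))" for u v
  define \<phi>' where "\<phi>' x = rep (\<phi> x)" for x
  have closed: "\<And>x y. x \<in> T \<Longrightarrow> y \<in> T \<Longrightarrow> g x y \<in> T"
    and assoc: "\<And>x y z. x \<in> T \<Longrightarrow> y \<in> T \<Longrightarrow> z \<in> T \<Longrightarrow> g (g x y) z = g x (g y z)"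
    using T by (auto simp: inverse_semigroup_def semigroup_on_def)
  have \<phi>T: "\<phi> x \<in> T" if "x \<in> S" for x
    using \<phi> that by (auto simp: semigroup_embedding_def)
  have "set_inv_term w \<subseteq> S \<Longrightarrow> \<psi> w \<in> T" for w
    unfolding \<psi>_def
    by (induction w) (auto intro: \<phi>T closed the_inverse_props(1)[OF T])
  then have T0T: "T0 \<subseteq> T" by (auto simp: T0_def W_def)
  have rep: "rep t \<in> W" "\<psi> (rep t) = t" if "t \<in> T0" for t
    using someI_ex[of "\<lambda>w. w \<in> W \<and> \<psi> w = t"] that by (auto simp: rep_def T0_def)
  have T0g: "g s t \<in> T0" if "s \<in> T0" "t \<in> T0" for s t
  proof -
    obtain u v where "u \<in> W" "v \<in> W" "s = \<psi> u" "t = \<psi> v" using \<open>s \<in> T0\<close> \<open>t \<in> T0\<close>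
      by (auto simp: T0_def)
    then have "Mul u v \<in> W" "\<psi> (Mul u v) = g s t" by (auto simp: W_def \<psi>_def)
    then show ?thesis unfolding T0_def by (metis imageI)
  qed
  have T0i: "the_inverse T g s \<in> T0" if "s \<in> T0" for s
  proof -
    obtain u where "u \<in> W" "s = \<psi> u" using \<open>s \<in> T0\<close> by (auto simp: T0_def)
    then have "Inv u \<in> W" "\<psi> (Inv u) = the_inverse T g s" by (auto simp: W_def \<psi>_def)
    then show ?thesis unfolding T0_def by (metis imageI)
  qed
  have T0\<phi>: "\<phi> x \<in> T0" if "x \<in> S" for x
  proof -
    have "Gen x \<in> W" "\<psi> (Gen x) = \<phi> x" using that by (auto simp: W_def \<psi>_def)
    then show ?thesis unfolding T0_def by (metis imageI)
  qed
  have \<psi>T': "\<psi> u \<in> T0" "rep (\<psi> u) = u" if "u \<in> T'" for u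
    using that by (auto simp: T'_def rep)
  have repT': "rep t \<in> T'" if "t \<in> T0" for t using that by (auto simp: T'_def)
  have inj: "inj_on \<psi> T'" by (metis \<psi>T'(2) inj_onI)
  have \<psi>g: "\<psi> (g' u v) = g (\<psi> u) (\<psi> v)" if "u \<in> T'" "v \<in> T'" for u v
    using that by (auto simp: g'_def rep \<psi>T' T0g)
  have g'T': "g' u v \<in> T'" if "u \<in> T'" "v \<in> T'" for u v
    using that by (auto simp: g'_def repT' \<psi>T' T0g)
  have sg: "semigroup_on T' g'"
    unfolding semigroup_on_def
  proof (intro conjI ballI)
    show "T' \<noteq> {}" using ne T0\<phi> by (auto simp: T'_def)
    show "g' x y \<in> T'" if "x \<in> T'" "y \<in> T'" for x y using that by (rule g'T')
    fix x y z assume *: "x \<in> T'" "y \<in> T'" "z \<in> T'"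
    have "\<psi> (g' (g' x y) z) = \<psi> (g' x (g' y z))"
      using * \<psi>T'(1) T0T by (simp add: \<psi>g g'T' assoc subset_iff)
    then show "g' (g' x y) z = g' x (g' y z)"
      using inj * by (auto simp: inj_on_def g'T')
  qed
  have inv_iff: "is_inverse g' u v \<longleftrightarrow> is_inverse g (\<psi> u) (\<psi> v)"
    if "u \<in> T'" "v \<in> T'" for u v
  proof -
    have "g' (g' u v) u = u \<longleftrightarrow> \<psi> (g' (g' u v) u) = \<psi> u"
      "g' (g' v u) v = v \<longleftrightarrow> \<psi> (g' (g' v u) v) = \<psi> v"
      using inj that by (auto simp: inj_on_def g'T')
    then show ?thesis using that by (simp add: is_inverse_def \<psi>g g'T')
  qed
  have repinv: "rep (the_inverse T g (\<psi> u)) \<in> T'"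
    "is_inverse g' u (rep (the_inverse T g (\<psi> u)))" if "u \<in> T'" for u
  proof -
    show 1: "rep (the_inverse T g (\<psi> u)) \<in> T'" using that by (intro repT' T0i \<psi>T')
    have "\<psi> u \<in> T" using \<psi>T'(1)[OF that] T0T by blast
    then show "is_inverse g' u (rep (the_inverse T g (\<psi> u)))"
      using inv_iff[OF that 1] rep(2)[OF T0i[OF \<psi>T'(1)[OF that]]] the_inverse_props(2)[OF T]
      by simp
  qed
  have inv': "inverse_semigroup T' g'"
    unfolding inverse_semigroup_def
  proof (intro conjI ballI sg ex_ex1I)
    fix u assume u: "u \<in> T'"
    show "\<exists>y. y \<in> T' \<and> is_inverse g' u y" using repinv[OF u] by blast
    fix v w assume *: "v \<in> T' \<and> is_inverse g' u v" "w \<in> T' \<and> is_inverse g' u w"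
    have "\<psi> v = \<psi> w"
      using the_inverse_eqI[OF T, of "\<psi> u" "\<psi> v"] the_inverse_eqI[OF T, of "\<psi> u" "\<psi> w"]
        * u inv_iff \<psi>T'(1) T0T by (metis subsetD)
    then show "v = w" using * inj by (auto simp: inj_on_def)
  qed
  have \<psi>i: "\<psi> (the_inverse T' g' u) = the_inverse T g (\<psi> u)" if "u \<in> T'" for u
    using the_inverse_eqI[OF inv' that repinv[OF that]] rep(2)[OF T0i[OF \<psi>T'(1)[OF that]]] by simp
  have \<psi>\<phi>: "\<psi> (\<phi>' x) = \<phi> x" if "x \<in> S" for x
    using rep(2)[OF T0\<phi>[OF that]] by (simp add: \<phi>'_def)
  have emb: "semigroup_embedding S f T' g' \<phi>'"
    unfolding semigroup_embedding_def
  proof (intro conjI ballI)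
    show "\<phi>' ` S \<subseteq> T'" by (auto simp: \<phi>'_def intro: repT' T0\<phi>)
    show "inj_on \<phi>' S"
      using \<phi> \<psi>\<phi> unfolding semigroup_embedding_def inj_on_def by metis
    show "\<phi>' (f x y) = g' (\<phi>' x) (\<phi>' y)" if "x \<in> S" "y \<in> S" for x y
      using \<phi> \<psi>\<phi>[OF that(1)] \<psi>\<phi>[OF that(2)] that
      by (simp add: semigroup_embedding_def g'_def) (simp add: \<phi>'_def)
  qed
  show thesis using that[OF inv' emb inj] \<psi>\<phi> \<psi>g \<psi>i by blast
qed

lemma left_ample_if_embedding:
  fixes S :: "'a set" and T :: "'b set"
  assumes S: "semigroup_on S f" and E: "left_ample_embedding S f T g \<phi>"
  shows "left_ample S f"
proof -
  have ne: "S \<noteq> {}" and T: "inverse_semigroup T g" and \<phi>: "semigroup_embedding S f T g \<phi>"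
    and L: "\<And>x. x \<in> S \<Longrightarrow> g (\<phi> x) (the_inverse T g (\<phi> x)) \<in> \<phi> ` S"
    using S E by (auto simp: semigroup_on_def left_ample_embedding_def)
  obtain T' :: "'a inv_term set" and g' and \<psi> :: "'a inv_term \<Rightarrow> 'b" and \<phi>'
    where T': "inverse_semigroup T' g'" and \<phi>': "semigroup_embedding S f T' g' \<phi>'"
      and inj: "inj_on \<psi> T'" and \<psi>\<phi>: "\<forall>x\<in>S. \<psi> (\<phi>' x) = \<phi> x"
      and \<psi>g: "\<forall>u\<in>T'. \<forall>v\<in>T'. \<psi> (g' u v) = g (\<psi> u) (\<psi> v)"
      and \<psi>i: "\<forall>u\<in>T'. \<psi> (the_inverse T' g' u) = the_inverse T g (\<psi> u)"
    by (rule inverse_semigroup_of_terms[OF ne T \<phi>])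
  have "g' (\<phi>' x) (the_inverse T' g' (\<phi>' x)) \<in> \<phi>' ` S" if x: "x \<in> S" for x
  proof -
    have mem: "\<phi>' y \<in> T'" if "y \<in> S" for y
      using \<phi>' that by (auto simp: semigroup_embedding_def)
    have i: "the_inverse T' g' (\<phi>' x) \<in> T'" using the_inverse_props(1)[OF T' mem[OF x]] .
    obtain y where y: "y \<in> S" "g (\<phi> x) (the_inverse T g (\<phi> x)) = \<phi> y" using L[OF x] by auto
    have "\<psi> (g' (\<phi>' x) (the_inverse T' g' (\<phi>' x))) = \<psi> (\<phi>' y)"
      using y x by (simp add: \<psi>g mem i \<psi>i \<psi>\<phi>)
    moreover have "g' (\<phi>' x) (the_inverse T' g' (\<phi>' x)) \<in> T'"
      using T' mem[OF x] i by (auto simp: inverse_semigroup_def semigroup_on_def)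
    ultimately have "g' (\<phi>' x) (the_inverse T' g' (\<phi>' x)) = \<phi>' y"
      using inj mem[OF y(1)] by (auto simp: inj_on_def)
    then show ?thesis using y(1) by simp
  qed
  then show ?thesis using S T' \<phi>' unfolding left_ample_def left_ample_embedding_def by blast
qed

lemma right_ample_if_embedding:
  fixes S :: "'a set" and T :: "'b set"
  assumes S: "semigroup_on S f" and E: "right_ample_embedding S f T g \<phi>"
  shows "right_ample S f"
proof -
  have ne: "S \<noteq> {}" and T: "inverse_semigroup T g" and \<phi>: "semigroup_embedding S f T g \<phi>"
    and L: "\<And>x. x \<in> S \<Longrightarrow> g (the_inverse T g (\<phi> x)) (\<phi> x) \<in> \<phi> ` S"
    using S E by (auto simp: semigroup_on_def right_ample_embedding_def)
  obtain T' :: "'a inv_term set" and g' and \<psi> :: "'a inv_term \<Rightarrow> 'b" and \<phi>'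
    where T': "inverse_semigroup T' g'" and \<phi>': "semigroup_embedding S f T' g' \<phi>'"
      and inj: "inj_on \<psi> T'" and \<psi>\<phi>: "\<forall>x\<in>S. \<psi> (\<phi>' x) = \<phi> x"
      and \<psi>g: "\<forall>u\<in>T'. \<forall>v\<in>T'. \<psi> (g' u v) = g (\<psi> u) (\<psi> v)"
      and \<psi>i: "\<forall>u\<in>T'. \<psi> (the_inverse T' g' u) = the_inverse T g (\<psi> u)"
    by (rule inverse_semigroup_of_terms[OF ne T \<phi>])
  have "g' (the_inverse T' g' (\<phi>' x)) (\<phi>' x) \<in> \<phi>' ` S" if x: "x \<in> S" for x
  proof -
    have mem: "\<phi>' y \<in> T'" if "y \<in> S" for y
      using \<phi>' that by (auto simp: semigroup_embedding_def)
    have i: "the_inverse T' g' (\<phi>' x) \<in> T'" using the_inverse_props(1)[OF T' mem[OF x]] .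
    obtain y where y: "y \<in> S" "g (the_inverse T g (\<phi> x)) (\<phi> x) = \<phi> y" using L[OF x] by auto
    have "\<psi> (g' (the_inverse T' g' (\<phi>' x)) (\<phi>' x)) = \<psi> (\<phi>' y)"
      using y x by (simp add: \<psi>g mem i \<psi>i \<psi>\<phi>)
    moreover have "g' (the_inverse T' g' (\<phi>' x)) (\<phi>' x) \<in> T'"
      using T' mem[OF x] i by (auto simp: inverse_semigroup_def semigroup_on_def)
    ultimately have "g' (the_inverse T' g' (\<phi>' x)) (\<phi>' x) = \<phi>' y"
      using inj mem[OF y(1)] by (auto simp: inj_on_def)
    then show ?thesis using y(1) by simp
  qed
  then show ?thesis using S T' \<phi>' unfolding right_ample_def right_ample_embedding_def by blast
qed

end

theory Submission
  imports Defs
begin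

text \<open>
  Left ampleness of \<open>eB\<close> needs no embedding other than the inclusion into \<open>B\<close>: if \<open>x = ex\<close>, then
  \<open>xx\<inverse> = e(xx\<inverse>)\<close> lies in \<open>eB\<close> again.

  If \<open>eB\<close> were right ample, the idempotent \<open>x\<inverse>x\<close>, formed in a suitable inverse semigroup, would be
  the image of an idempotent \<open>y \<in> eB\<close>, so that every \<open>x \<in> eB\<close> would have an idempotent right
  identity \<open>y \<in> eB\<close> (lemma \<open>right_ample_imp_idempotent_right_identity\<close>). In a Brandt semigroup
  every nonzero idempotent is primitive (lemma \<open>nonzero_idempotent_primitive\<close>), and for this reason
  \<open>e\<close> is the only nonzero idempotent of \<open>eB\<close> (lemma \<open>one_sided_below_imp_eq\<close>). Hence
  \<open>xe = x\<close> for all \<open>x \<in> eB\<close>. By 0-simplicity \<open>B = BeB\<close>, and so \<open>e\<close> is a right identity of all of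
  \<open>B\<close>. Then \<open>bb\<inverse> = e = b\<inverse>b\<close> for every \<open>b \<noteq> 0\<close>, that is, \<open>B\<close> is a zero group
  (lemma \<open>one_sided_identity_imp_zero_group\<close>).

  The statement on \<open>Be\<close> is the left-right dual. The facts about the idempotents and the one-sided
  identities of \<open>B\<close> are stated so as to serve both sides. Throughout, the zero \<open>0\<close> of \<open>B\<close> is the
  parameter \<open>z\<close>.
\<close>

section \<open>Idempotent one-sided identities in ample semigroups\<close>

text \<open>
  The next two lemmas extract from one-sided ampleness a property of \<open>S\<close> alone, with no reference
  to the ambient inverse semigroup.
\<close>

lemma right_ample_imp_idempotent_right_identity:
  assumes "right_ample S f" and x: "x \<in> S"
  obtains y where "y \<in> idempotents S f" and "f x y = x"
proof -
  obtain T :: "'a inv_term set" and g \<phi>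
    where S: "semigroup_on S f" and T: "inverse_semigroup T g"
      and emb: "semigroup_embedding S f T g \<phi>"
      and R: "\<And>x. x \<in> S \<Longrightarrow> g (the_inverse T g (\<phi> x)) (\<phi> x) \<in> \<phi> ` S"
    using assms(1) unfolding right_ample_def right_ample_embedding_def by blast
  have hom: "\<And>u v. u \<in> S \<Longrightarrow> v \<in> S \<Longrightarrow> \<phi> (f u v) = g (\<phi> u) (\<phi> v)"
    and inj: "\<And>u v. u \<in> S \<Longrightarrow> v \<in> S \<Longrightarrow> \<phi> u = \<phi> v \<Longrightarrow> u = v"
    and mem: "\<And>u. u \<in> S \<Longrightarrow> \<phi> u \<in> T"
    using emb by (auto simp: semigroup_embedding_def inj_on_def)
  have Sc: "\<And>u v. u \<in> S \<Longrightarrow> v \<in> S \<Longrightarrow> f u v \<in> S"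
    using S by (auto simp: semigroup_on_def)
  have Tc: "\<And>u v. u \<in> T \<Longrightarrow> v \<in> T \<Longrightarrow> g u v \<in> T"
    and Ta: "\<And>u v w. u \<in> T \<Longrightarrow> v \<in> T \<Longrightarrow> w \<in> T \<Longrightarrow> g (g u v) w = g u (g v w)"
    using T by (auto simp: inverse_semigroup_def semigroup_on_def)
  define i where "i = the_inverse T g (\<phi> x)"
  have i: "i \<in> T" "g (g (\<phi> x) i) (\<phi> x) = \<phi> x" "g (g i (\<phi> x)) i = i"
    using the_inverse_props[OF T mem[OF x]] by (auto simp: i_def is_inverse_def)
  obtain y where y: "y \<in> S" "\<phi> y = g i (\<phi> x)"
    using R[OF x] by (auto simp: i_def)
  have "\<phi> (f x y) = \<phi> x"
    using i y x mem by (simp add: hom Ta)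
  moreover have "\<phi> (f y y) = \<phi> y"
    using i y x mem by (simp add: hom Tc flip: Ta)
  ultimately show thesis
    using that[of y] inj Sc x y(1) by (simp add: idempotents_def)
qed

lemma left_ample_imp_idempotent_left_identity:
  assumes "left_ample S f" and x: "x \<in> S"
  obtains y where "y \<in> idempotents S f" and "f y x = x"
proof -
  obtain T :: "'a inv_term set" and g \<phi>
    where S: "semigroup_on S f" and T: "inverse_semigroup T g"
      and emb: "semigroup_embedding S f T g \<phi>"
      and L: "\<And>x. x \<in> S \<Longrightarrow> g (\<phi> x) (the_inverse T g (\<phi> x)) \<in> \<phi> ` S"
    using assms(1) unfolding left_ample_def left_ample_embedding_def by blast
  have hom: "\<And>u v. u \<in> S \<Longrightarrow> v \<in> S \<Longrightarrow> \<phi> (f u v) = g (\<phi> u) (\<phi> v)"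
    and inj: "\<And>u v. u \<in> S \<Longrightarrow> v \<in> S \<Longrightarrow> \<phi> u = \<phi> v \<Longrightarrow> u = v"
    and mem: "\<And>u. u \<in> S \<Longrightarrow> \<phi> u \<in> T"
    using emb by (auto simp: semigroup_embedding_def inj_on_def)
  have Sc: "\<And>u v. u \<in> S \<Longrightarrow> v \<in> S \<Longrightarrow> f u v \<in> S"
    using S by (auto simp: semigroup_on_def)
  have Tc: "\<And>u v. u \<in> T \<Longrightarrow> v \<in> T \<Longrightarrow> g u v \<in> T"
    and Ta: "\<And>u v w. u \<in> T \<Longrightarrow> v \<in> T \<Longrightarrow> w \<in> T \<Longrightarrow> g (g u v) w = g u (g v w)"
    using T by (auto simp: inverse_semigroup_def semigroup_on_def)
  define i where "i = the_inverse T g (\<phi> x)"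
  have i: "i \<in> T" "g (g (\<phi> x) i) (\<phi> x) = \<phi> x" "g (g i (\<phi> x)) i = i"
    using the_inverse_props[OF T mem[OF x]] by (auto simp: i_def is_inverse_def)
  obtain y where y: "y \<in> S" "\<phi> y = g (\<phi> x) i"
    using L[OF x] by (auto simp: i_def)
  have "\<phi> (f y x) = \<phi> x"
    using i y x by (simp add: hom)
  moreover have "\<phi> (f y y) = \<phi> y"
    using i y x mem by (simp add: hom Tc flip: Ta)
  ultimately show thesis
    using that[of y] inj Sc x y(1) by (simp add: idempotents_def)
qed

section \<open>Idempotents of a Brandt semigroup\<close>

locale brandt =
  fixes B :: "'a set" and f :: "'a \<Rightarrow> 'a \<Rightarrow> 'a" (infixl "\<cdot>" 70) and z :: 'a
  assumes brandt: "brandt_semigroup B f z"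
begin

lemma inverse_sg: "inverse_semigroup B f"
  and zero_simple: "zero_simple B f z"
  using brandt by (auto simp: brandt_semigroup_def completely_zero_simple_def)

lemma closed [simp]: "x \<in> B \<Longrightarrow> y \<in> B \<Longrightarrow> x \<cdot> y \<in> B"
  and assoc: "x \<in> B \<Longrightarrow> y \<in> B \<Longrightarrow> w \<in> B \<Longrightarrow> x \<cdot> y \<cdot> w = x \<cdot> (y \<cdot> w)"
  and zero_in [simp]: "z \<in> B"
  and zero_left [simp]: "x \<in> B \<Longrightarrow> z \<cdot> x = z"
  and zero_right [simp]: "x \<in> B \<Longrightarrow> x \<cdot> z = z"
  using zero_simple by (auto simp: zero_simple_def semigroup_on_def is_zero_def)

lemma inverseE:
  assumes "x \<in> B"
  obtains i where "i \<in> B" and "the_inverse B f x = i" and "x \<cdot> i \<cdot> x = x" and "i \<cdot> x \<cdot> i = i"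
  using the_inverse_props[OF inverse_sg assms] by (auto simp: is_inverse_def)

text \<open>The ideal \<open>BeB\<close> contains \<open>e = eee \<noteq> 0\<close>, so it is \<open>B\<close> by 0-simplicity.\<close>

lemma factor_through_idempotent:
  assumes e: "e \<in> idempotents B f - {z}" and b: "b \<in> B"
  obtains s t where "s \<in> B" and "t \<in> B" and "b = s \<cdot> e \<cdot> t"
proof -
  let ?A = "{s \<cdot> e \<cdot> t | s t. s \<in> B \<and> t \<in> B}"
  have eB: "e \<in> B" and ee: "e \<cdot> e = e" and ez: "e \<noteq> z"
    using e by (auto simp: idempotents_def)
  have eA: "e \<in> ?A"
    using eB ee by (metis (mono_tags, lifting) mem_Collect_eq)
  have "two_sided_ideal B f ?A"
    unfolding two_sided_ideal_def
  proof (intro conjI ballI)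
    show "?A \<noteq> {}" using eA by blast
    show "?A \<subseteq> B" using eB by auto
    fix s a assume s: "s \<in> B" and "a \<in> ?A"
    then obtain p q where pq: "p \<in> B" "q \<in> B" "a = p \<cdot> e \<cdot> q" by blast
    then have "s \<cdot> a = s \<cdot> p \<cdot> e \<cdot> q" "a \<cdot> s = p \<cdot> e \<cdot> (q \<cdot> s)"
      using s eB by (simp_all add: assoc)
    then show "s \<cdot> a \<in> ?A" "a \<cdot> s \<in> ?A"
      using s pq closed by blast+
  qed
  then have "?A = B"
    using zero_simple eA ez unfolding zero_simple_def by blast
  then show thesis using b that by blast
qed

text \<open>
  Let \<open>p\<close> be primitive and write \<open>e = st\<close> with \<open>s \<in> eBp\<close> and \<open>t \<in> pBe\<close>. The map
  \<open>h \<mapsto> ths\<close> sends nonzero idempotents below \<open>e\<close> to nonzero idempotents below \<open>p\<close>, and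
  \<open>k \<mapsto> skt\<close> inverts it. So an idempotent \<open>h\<close> between \<open>0\<close> and \<open>e\<close> goes to \<open>p\<close>, and back to
  \<open>spt = e\<close>.
\<close>

lemma nonzero_idempotent_primitive:
  assumes e: "e \<in> idempotents B f - {z}"
  shows "primitive_idempotent B f z e"
  unfolding primitive_idempotent_def
proof (intro conjI ballI impI)
  show "e \<in> idempotents B f - {z}" by (rule e)
  obtain p where "primitive_idempotent B f z p"
    using brandt by (auto simp: brandt_semigroup_def completely_zero_simple_def)
  then have p: "p \<in> idempotents B f - {z}"
    and prim: "\<And>k. k \<in> idempotents B f - {z} \<Longrightarrow> p \<cdot> k = k \<Longrightarrow> k \<cdot> p = k \<Longrightarrow> k = p"
    by (auto simp: primitive_idempotent_def)
  have eB: "e \<in> B" and ee: "e \<cdot> e = e" and pB: "p \<in> B" and pp: "p \<cdot> p = p"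
    using e p by (auto simp: idempotents_def)
  obtain s0 t0 where st0: "s0 \<in> B" "t0 \<in> B" "e = s0 \<cdot> p \<cdot> t0"
    using factor_through_idempotent[OF p eB] by blast
  define s where "s = e \<cdot> s0 \<cdot> p"
  define t where "t = p \<cdot> t0 \<cdot> e"
  have sB: "s \<in> B" and tB: "t \<in> B" using st0 eB pB by (auto simp: s_def t_def)
  have sp: "s \<cdot> p = s" using st0 eB pB pp by (simp add: s_def assoc)
  have pt: "p \<cdot> t = t" using st0 eB pB pp by (simp add: t_def flip: assoc)
  have st: "s \<cdot> t = e"
  proof -
    have "s \<cdot> t = e \<cdot> (s0 \<cdot> (p \<cdot> p) \<cdot> t0) \<cdot> e"
      using st0(1,2) eB pB by (simp add: s_def t_def assoc)
    also have "\<dots> = e" using st0(3) pp ee by simp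
    finally show ?thesis .
  qed
  fix h assume h: "h \<in> idempotents B f - {z}" and below: "e \<cdot> h = h \<and> h \<cdot> e = h"
  have hB: "h \<in> B" and hh: "h \<cdot> h = h" using h by (auto simp: idempotents_def)
  define k where "k = t \<cdot> h \<cdot> s"
  have kB: "k \<in> B" using tB hB sB by (simp add: k_def)
  have recover: "s \<cdot> k \<cdot> t = h"
  proof -
    have "s \<cdot> k \<cdot> t = (s \<cdot> t) \<cdot> h \<cdot> (s \<cdot> t)"
      using sB tB hB by (simp add: k_def assoc)
    then show ?thesis using st below by simp
  qed
  have "k \<cdot> k = t \<cdot> (h \<cdot> (s \<cdot> t) \<cdot> h) \<cdot> s"
    using sB tB hB by (simp add: k_def assoc)
  then have "k \<cdot> k = k" using st below hh by (simp add: k_def)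
  moreover have "k \<noteq> z" using recover h sB tB by auto
  moreover have "p \<cdot> k = k"
    using sB tB hB pB pt by (simp add: k_def flip: assoc)
  moreover have "k \<cdot> p = k"
    using sB tB hB pB sp by (simp add: k_def assoc)
  ultimately have "k = p" using prim kB by (auto simp: idempotents_def)
  then show "h = e" using recover sp st by simp
qed

text \<open>
  Here uniqueness of inverses enters. If \<open>ey = y\<close>, then \<open>ye\<close> is a nonzero idempotent below \<open>e\<close>, so
  \<open>ye = e\<close> by primitivity. This makes \<open>y\<close> an inverse of \<open>e\<close>, but \<open>e\<close> is its own inverse. The case
  \<open>ye = y\<close> is dual, with \<open>ey\<close> in place of \<open>ye\<close>.
\<close>

lemma one_sided_below_imp_eq:
  assumes e: "e \<in> idempotents B f - {z}" and y: "y \<in> idempotents B f - {z}"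
    and below: "e \<cdot> y = y \<or> y \<cdot> e = y"
  shows "y = e"
proof -
  have eB: "e \<in> B" and ee: "e \<cdot> e = e" and yB: "y \<in> B" and yy: "y \<cdot> y = y" and yz: "y \<noteq> z"
    using e y by (auto simp: idempotents_def)
  have prim: "\<And>h. h \<in> B \<Longrightarrow> h \<cdot> h = h \<Longrightarrow> h \<noteq> z \<Longrightarrow> e \<cdot> h = h \<Longrightarrow> h \<cdot> e = h \<Longrightarrow> h = e"
    using nonzero_idempotent_primitive[OF e]
    by (auto simp: primitive_idempotent_def idempotents_def)
  have "is_inverse f e y"
    using below
  proof
    assume *: "e \<cdot> y = y"
    have yey: "y \<cdot> e \<cdot> y = y" using * eB yB yy by (simp add: assoc)
    have "y \<cdot> e = e"
    proof (rule prim)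
      show "y \<cdot> e \<in> B" using eB yB by simp
      show "y \<cdot> e \<cdot> (y \<cdot> e) = y \<cdot> e" using yey eB yB by (simp flip: assoc)
      show "y \<cdot> e \<noteq> z" using yey yz yB by (metis zero_left)
      show "e \<cdot> (y \<cdot> e) = y \<cdot> e" using * eB yB by (simp flip: assoc)
      show "y \<cdot> e \<cdot> e = y \<cdot> e" using ee eB yB by (simp add: assoc)
    qed
    then show ?thesis using * yey unfolding is_inverse_def by simp
  next
    assume *: "y \<cdot> e = y"
    have yey: "y \<cdot> e \<cdot> y = y" using * yy by simp
    have "e \<cdot> y = e"
    proof (rule prim)
      show "e \<cdot> y \<in> B" using eB yB by simp
      show "e \<cdot> y \<cdot> (e \<cdot> y) = e \<cdot> y" using yey eB yB by (simp add: assoc)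
      show "e \<cdot> y \<noteq> z" using yey yz yB eB by (metis assoc zero_right)
      show "e \<cdot> (e \<cdot> y) = e \<cdot> y" using ee eB yB by (simp flip: assoc)
      show "e \<cdot> y \<cdot> e = e \<cdot> y" using * eB yB by (simp add: assoc)
    qed
    then show ?thesis using yey ee unfolding is_inverse_def by simp
  qed
  moreover have "is_inverse f e e" using ee by (simp add: is_inverse_def)
  ultimately show ?thesis
    using the_inverse_eqI[OF inverse_sg eB] eB yB by metis
qed

text \<open>
  For \<open>b \<noteq> 0\<close> the idempotents \<open>bb\<inverse>\<close> and \<open>b\<inverse>b\<close> lie below the one-sided identity \<open>e\<close> on one side,
  which is all that the preceding lemma asks for; so both are \<open>e\<close>.
\<close>

lemma one_sided_identity_imp_zero_group:
  assumes e: "e \<in> idempotents B f - {z}"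
    and ident: "(\<forall>b\<in>B. e \<cdot> b = b) \<or> (\<forall>b\<in>B. b \<cdot> e = b)"
  shows "zero_group B f"
proof -
  have eB: "e \<in> B" and ez: "e \<noteq> z"
    using e by (auto simp: idempotents_def)
  have only: "y = e" if "y \<in> B" "y \<cdot> y = y" "y \<noteq> z" for y
    using one_sided_below_imp_eq[OF e] ident that by (auto simp: idempotents_def)
  have inv: "\<exists>i. i \<in> B - {z} \<and> b \<cdot> i = e \<and> i \<cdot> b = e" if b: "b \<in> B - {z}" for b
  proof -
    have bB: "b \<in> B" and bz: "b \<noteq> z" using b by auto
    obtain i where i: "i \<in> B" "b \<cdot> i \<cdot> b = b" "i \<cdot> b \<cdot> i = i"
      using inverseE[OF bB] by blast
    have "b \<cdot> i = e"
    proof (rule only)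
      show "b \<cdot> i \<cdot> (b \<cdot> i) = b \<cdot> i" using i bB by (simp flip: assoc)
      show "b \<cdot> i \<noteq> z" using i(2) bz bB by (metis zero_left)
    qed (use i bB in simp)
    moreover have "i \<cdot> b = e"
    proof (rule only)
      show "i \<cdot> b \<cdot> (i \<cdot> b) = i \<cdot> b" using i bB by (simp flip: assoc)
      show "i \<cdot> b \<noteq> z" using i(1,2) bz bB by (metis assoc zero_right)
    qed (use i bB in simp)
    moreover have "i \<noteq> z" using i bz bB by auto
    ultimately show ?thesis using i by blast
  qed
  have e_left: "e \<cdot> b = b" if b: "b \<in> B" for b
  proof (cases "b = z")
    case False
    then obtain i where "i \<in> B" "b \<cdot> i = e" "i \<cdot> b = e" using inv b by blast
    then have "e \<cdot> b = b \<cdot> e" using b assoc by metis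
    then show ?thesis using ident b by auto
  qed (use eB in simp)
  have "group \<lparr>carrier = B - {z}, mult = f, one = e\<rparr>"
  proof (rule groupI; simp)
    show "e \<in> B \<and> e \<noteq> z" using eB ez by simp
    show "x \<cdot> y \<noteq> z" if x: "x \<in> B \<and> x \<noteq> z" and y: "y \<in> B \<and> y \<noteq> z" for x y
    proof
      assume xy: "x \<cdot> y = z"
      obtain i where i: "i \<in> B" "i \<cdot> x = e" using inv x by blast
      have "y = i \<cdot> x \<cdot> y" using i e_left y by simp
      also have "\<dots> = z" using i(1) xy x y assoc[of i x y] by simp
      finally show False using y by simp
    qed
    show "x \<cdot> y \<cdot> w = x \<cdot> (y \<cdot> w)"
      if "x \<in> B \<and> x \<noteq> z" "y \<in> B \<and> y \<noteq> z" "w \<in> B \<and> w \<noteq> z" for x y w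
      using that by (simp add: assoc)
    show "e \<cdot> x = x" if "x \<in> B \<and> x \<noteq> z" for x using that e_left by simp
    show "\<exists>y\<in>B - {z}. y \<cdot> x = e" if "x \<in> B \<and> x \<noteq> z" for x
      using inv that by blast
  qed
  then show ?thesis
    unfolding zero_group_def is_zero_def by (metis zero_in zero_left zero_right)
qed

section \<open>The principal one-sided ideals of an idempotent\<close>

lemma mem_right_ideal_iff:
  assumes "e \<in> idempotents B f"
  shows "x \<in> {e \<cdot> b | b. b \<in> B} \<longleftrightarrow> x \<in> B \<and> e \<cdot> x = x"
proof -
  have "e \<in> B" "e \<cdot> e = e" using assms by (auto simp: idempotents_def)
  then show ?thesis by (force simp flip: assoc)
qed

lemma mem_left_ideal_iff:
  assumes "e \<in> idempotents B f"
  shows "x \<in> {b \<cdot> e | b. b \<in> B} \<longleftrightarrow> x \<in> B \<and> x \<cdot> e = x"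
proof -
  have "e \<in> B" "e \<cdot> e = e" using assms by (auto simp: idempotents_def)
  then show ?thesis by (force simp: assoc)
qed

lemma subsemigroup_right_ideal:
  assumes "e \<in> idempotents B f"
  shows "subsemigroup {e \<cdot> b | b. b \<in> B} B f"
proof -
  have "e \<in> B" using assms by (auto simp: idempotents_def)
  then show ?thesis
    unfolding subsemigroup_def subset_iff Ball_def mem_right_ideal_iff[OF assms]
    using zero_in by (auto simp flip: assoc)
qed

lemma subsemigroup_left_ideal:
  assumes "e \<in> idempotents B f"
  shows "subsemigroup {b \<cdot> e | b. b \<in> B} B f"
proof -
  have "e \<in> B" using assms by (auto simp: idempotents_def)
  then show ?thesis
    unfolding subsemigroup_def subset_iff Ball_def mem_left_ideal_iff[OF assms]
    using zero_in by (auto simp: assoc)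
qed

lemma semigroup_on_subsemigroup: "subsemigroup U B f \<Longrightarrow> semigroup_on U f"
  unfolding subsemigroup_def semigroup_on_def using assoc by (auto simp: subset_iff)

lemma left_ample_right_ideal:
  assumes e: "e \<in> idempotents B f"
  shows "left_ample {e \<cdot> b | b. b \<in> B} f"
proof (rule left_ample_if_embedding)
  let ?S = "{e \<cdot> b | b. b \<in> B}"
  have eB: "e \<in> B" using e by (auto simp: idempotents_def)
  show "semigroup_on ?S f"
    by (rule semigroup_on_subsemigroup[OF subsemigroup_right_ideal[OF e]])
  have "x \<cdot> the_inverse B f x \<in> ?S" if "x \<in> ?S" for x
  proof -
    have x: "x \<in> B" "e \<cdot> x = x" using that mem_right_ideal_iff[OF e] by blast+
    obtain i where "i \<in> B" "the_inverse B f x = i" using inverseE[OF x(1)] by blast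
    then show ?thesis
      unfolding mem_right_ideal_iff[OF e] using x eB by (simp flip: assoc)
  qed
  then show "left_ample_embedding ?S f B f id"
    using inverse_sg eB unfolding left_ample_embedding_def semigroup_embedding_def by auto
qed

lemma right_ample_left_ideal:
  assumes e: "e \<in> idempotents B f"
  shows "right_ample {b \<cdot> e | b. b \<in> B} f"
proof (rule right_ample_if_embedding)
  let ?S = "{b \<cdot> e | b. b \<in> B}"
  have eB: "e \<in> B" using e by (auto simp: idempotents_def)
  show "semigroup_on ?S f"
    by (rule semigroup_on_subsemigroup[OF subsemigroup_left_ideal[OF e]])
  have "the_inverse B f x \<cdot> x \<in> ?S" if "x \<in> ?S" for x
  proof -
    have x: "x \<in> B" "x \<cdot> e = x" using that mem_left_ideal_iff[OF e] by blast+
    obtain i where "i \<in> B" "the_inverse B f x = i" using inverseE[OF x(1)] by blast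
    then show ?thesis
      unfolding mem_left_ideal_iff[OF e] using x eB by (simp add: assoc)
  qed
  then show "right_ample_embedding ?S f B f id"
    using inverse_sg eB unfolding right_ample_embedding_def semigroup_embedding_def by auto
qed

text \<open>
  Right ampleness provides idempotent right identities in \<open>eB\<close>, and \<open>e\<close> is the only nonzero
  candidate; so \<open>e\<close> fixes \<open>eB\<close> from the right, and then \<open>B = BeB\<close> as well.
\<close>

lemma right_ample_right_ideal_imp_zero_group:
  assumes e: "e \<in> idempotents B f - {z}" and ample: "right_ample {e \<cdot> b | b. b \<in> B} f"
  shows "zero_group B f"
proof (rule one_sided_identity_imp_zero_group[OF e], rule disjI2, rule ballI)
  let ?S = "{e \<cdot> b | b. b \<in> B}"
  have eI: "e \<in> idempotents B f" and eB: "e \<in> B" using e by (auto simp: idempotents_def)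
  have fixed: "x \<cdot> e = x" if x: "x \<in> ?S" for x
  proof (cases "x = z")
    case False
    obtain y where y: "y \<in> idempotents ?S f" "x \<cdot> y = x"
      using right_ample_imp_idempotent_right_identity[OF ample x] .
    then have "y \<in> ?S" "y \<cdot> y = y" by (auto simp: idempotents_def)
    then have "y \<in> B" "e \<cdot> y = y" "y \<cdot> y = y" using mem_right_ideal_iff[OF eI] by blast+
    moreover have "y \<noteq> z" using y(2) x False eB by auto
    ultimately have "y = e" using one_sided_below_imp_eq[OF e] by (simp add: idempotents_def)
    then show ?thesis using y by simp
  qed (use eB in simp)
  fix b assume "b \<in> B"
  then obtain s t where st: "s \<in> B" "t \<in> B" "b = s \<cdot> e \<cdot> t"
    using factor_through_idempotent[OF e] by blast
  have "b \<cdot> e = s \<cdot> (e \<cdot> t \<cdot> e)" using st eB by (simp add: assoc)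
  also have "e \<cdot> t \<cdot> e = e \<cdot> t" using fixed st(2) by blast
  also have "s \<cdot> (e \<cdot> t) = b" using st eB by (simp add: assoc)
  finally show "b \<cdot> e = b" .
qed

lemma left_ample_left_ideal_imp_zero_group:
  assumes e: "e \<in> idempotents B f - {z}" and ample: "left_ample {b \<cdot> e | b. b \<in> B} f"
  shows "zero_group B f"
proof (rule one_sided_identity_imp_zero_group[OF e], rule disjI1, rule ballI)
  let ?S = "{b \<cdot> e | b. b \<in> B}"
  have eI: "e \<in> idempotents B f" and eB: "e \<in> B" using e by (auto simp: idempotents_def)
  have fixed: "e \<cdot> x = x" if x: "x \<in> ?S" for x
  proof (cases "x = z")
    case False
    obtain y where y: "y \<in> idempotents ?S f" "y \<cdot> x = x"
      using left_ample_imp_idempotent_left_identity[OF ample x] .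
    then have "y \<in> ?S" "y \<cdot> y = y" by (auto simp: idempotents_def)
    then have "y \<in> B" "y \<cdot> e = y" "y \<cdot> y = y" using mem_left_ideal_iff[OF eI] by blast+
    moreover have "y \<noteq> z" using y(2) x False eB by auto
    ultimately have "y = e" using one_sided_below_imp_eq[OF e] by (simp add: idempotents_def)
    then show ?thesis using y by simp
  qed (use eB in simp)
  fix b assume "b \<in> B"
  then obtain s t where st: "s \<in> B" "t \<in> B" "b = s \<cdot> e \<cdot> t"
    using factor_through_idempotent[OF e] by blast
  have "e \<cdot> b = e \<cdot> (s \<cdot> e) \<cdot> t" using st eB by (simp add: assoc)
  also have "e \<cdot> (s \<cdot> e) = s \<cdot> e" using fixed st(1) by blast
  finally show "e \<cdot> b = b" using st(3) by simp
qed

end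

theorem theorem3p5:
  fixes B :: "'a set" and f :: "'a \<Rightarrow> 'a \<Rightarrow> 'a" and z :: 'a
  assumes "brandt_semigroup B f z"
    and "\<not> zero_group B f"
  shows "\<forall>e \<in> idempotents B f - {z}.
    subsemigroup {f e b | b. b \<in> B} B f \<and> strict_left_ample {f e b | b. b \<in> B} f \<and>
    subsemigroup {f b e | b. b \<in> B} B f \<and> strict_right_ample {f b e | b. b \<in> B} f"
proof -
  interpret brandt B f z by (rule brandt.intro) (rule assms(1))
  show ?thesis
    unfolding strict_left_ample_def strict_right_ample_def
    using assms(2) subsemigroup_right_ideal subsemigroup_left_ideal
      left_ample_right_ideal right_ample_left_ideal
      right_ample_right_ideal_imp_zero_group left_ample_left_ideal_imp_zero_group
    by blast
qed

end
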